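(* Let $m,n\in\mathbb N$, let $\mathbf d=(d_j)_{j=1}^m\in\mathbb N^m$ with $d_1\ge d_2\ge\dots\ge d_m$, and let $\alpha=(\alpha_i)_{i=1}^n\in\mathbb R_{\ge 0}^n$ with $\alpha_1\ge\dots\ge\alpha_n$, such that $d_1\le n$. For each $j\in\{1,\dots,m\}$ let $\mu_j=(\mu_{i,j})_{i=1}^{d_j}\in\mathbb R_{\ge 0}^{d_j}$ be a vector with non-increasing entries, let $\mathcal M=\{\mu_j\}_{j=1}^m$, and set $$\sigma_{\mathcal M}:=\sum_{j=1}^m(\mu_j\oplus 0_{d_1-d_j})\in\mathbb R_{\ge 0}^{d_1},$$ where $\mu_j\oplus 0_{d_1-d_j}$ denotes $\mu_j$ followed by $d_1-d_j$ zeros. Then the pair $(\alpha,\mathcal M)$ is admissible if and only if $\alpha\prec\sigma_{\mathcal M}$.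
   Context: Designs: an $(\alpha,\mathbf d)$-design is an $m$-tuple $\Phi=(\mathcal F_j)_{j=1}^m$ where each $\mathcal F_j=\{f_{ij}\}_{i=1}^n$ is a sequence of $n$ vectors in $\mathbb C^{d_j}$ (not necessarily a frame) and $\sum_{j=1}^m\|f_{ij}\|^2=\alpha_i$ for every $i\in\{1,\dots,n\}$. The set of all $(\alpha,\mathbf d)$-designs is denoted $\mathcal D(\alpha,\mathbf d)$. Frame operator: for a sequence $\mathcal F=\{f_i\}_{i=1}^n$ in $\mathbb C^k$, $S_{\mathcal F}\in\mathcal M_k(\mathbb C)$ is the positive semidefinite matrix $S_{\mathcal F}f=\sum_{i=1}^n\langle f,f_i\rangle f_i$. For a selfadjoint $A\in\mathcal M_k(\mathbb C)$, $\lambda(A)\in\mathbb R^k$ is the vector of eigenvalues of $A$ counted with multiplicity and arranged in non-increasing order. Admissibility: the pair $(\alpha,\mathcal M)$, $\mathcal M=\{\mu_j\}_{j=1}^m$, is admissible if there exists $\Phi=(\mathcal F_j)_{j=1}^m\in\mathcal D(\alpha,\mathbf d)$ with $\lambda(S_{\mathcal F_j})=\mu_j$ for every $j\in\{1,\dots,m\}$. Majorization: for $x,y\in\mathbb R^k$, $x\prec y$ means $\sum_{i=1}^{\ell}x_i^\downarrow\le\sum_{i=1}^{\ell}y_i^\downarrow$ for $1\le \ell\le k$ with equality for $\ell=k$, where $x^\downarrow$ is the non-increasing rearrangement of $x$. For non-negative vectors of different lengths, the shorter one is first padded with zeros at the end to the length of the longer one. *)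

theory Defs
  imports
    "Jordan_Normal_Form.Char_Poly"
    "Jordan_Normal_Form.Schur_Decomposition"
    "HOL-Analysis.L2_Norm"
begin

text \<open>
  Finite real vectors, families of dimensions, sequences of vectors and designs are
  lists, so all indices start at \<open>0\<close>: the entry of \<open>\<mu>\<^sub>j\<close> with index \<open>i\<close>
  is \<open>M ! j ! i\<close> and \<open>f\<^sub>i\<^sub>j\<close> is \<open>\<Phi> ! j ! i\<close>.
\<close>

definition cvec_norm :: "complex vec \<Rightarrow> real" where
  "cvec_norm v = L2_set (\<lambda>r. cmod (v $ r)) {..<dim_vec v}"

definition designs :: "real list \<Rightarrow> nat list \<Rightarrow> complex vec list list set" where
  "designs \<alpha> d =
    {\<Phi>. length \<Phi> = length d
      \<and> (\<forall>j < length d. length (\<Phi> ! j) = length \<alpha> \<and> set (\<Phi> ! j) \<subseteq> carrier_vec (d ! j))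
      \<and> (\<forall>i < length \<alpha>. (\<Sum>j < length d. (cvec_norm (\<Phi> ! j ! i))\<^sup>2) = \<alpha> ! i)}"

text \<open>The map \<open>f \<mapsto> \<Sum>\<^sub>i \<langle>f, f\<^sub>i\<rangle> f\<^sub>i\<close> on \<open>\<complex>\<^sup>k\<close>; the product \<open>\<bullet>c\<close>
  is linear in its first argument.\<close>

definition frame_map :: "nat \<Rightarrow> complex vec list \<Rightarrow> complex vec \<Rightarrow> complex vec" where
  "frame_map k F f =
    finsum_vec TYPE(complex) k (\<lambda>i. (f \<bullet>c (F ! i)) \<cdot>\<^sub>v (F ! i)) {..<length F}"

definition frame_operator :: "nat \<Rightarrow> complex vec list \<Rightarrow> complex mat" where
  "frame_operator k F = mat_of_cols k (map (\<lambda>c. frame_map k F (unit_vec k c)) [0..<k])"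

text \<open>Intended for selfadjoint \<open>A\<close> only: then all roots of the characteristic polynomial are
  real, so that \<open>Re\<close> loses nothing, and their algebraic and geometric multiplicities agree.\<close>

definition eigenvalue_vector :: "complex mat \<Rightarrow> real list" where
  "eigenvalue_vector A = rev (sorted_list_of_multiset (image_mset Re (proots (char_poly A))))"

definition admissible :: "real list \<Rightarrow> nat list \<Rightarrow> real list list \<Rightarrow> bool" where
  "admissible \<alpha> d M \<longleftrightarrow>
    (\<exists>\<Phi> \<in> designs \<alpha> d. \<forall>j < length d. eigenvalue_vector (frame_operator (d ! j) (\<Phi> ! j)) = M ! j)"

definition zero_pad :: "nat \<Rightarrow> real list \<Rightarrow> real list" where
  "zero_pad k x = x @ replicate (k - length x) 0"

definition decreasing_rearrangement :: "real list \<Rightarrow> real list" where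
  "decreasing_rearrangement x = rev (sort x)"

text \<open>For vectors of equal length the padding has no effect; for different lengths the relation
  is meant for non-negative vectors.\<close>

definition majorized_by :: "real list \<Rightarrow> real list \<Rightarrow> bool"  (infix \<open>\<prec>\<close> 50) where
  "x \<prec> y \<longleftrightarrow>
    (let k = max (length x) (length y);
         x' = decreasing_rearrangement (zero_pad k x);
         y' = decreasing_rearrangement (zero_pad k y)
     in (\<forall>l \<in> {1..k}. (\<Sum>i<l. x' ! i) \<le> (\<Sum>i<l. y' ! i)) \<and> (\<Sum>i<k. x' ! i) = (\<Sum>i<k. y' ! i))"

definition sigma_vector :: "nat list \<Rightarrow> real list list \<Rightarrow> real list" where
  "sigma_vector d M = map (\<lambda>i. \<Sum>j < length d. zero_pad (d ! 0) (M ! j) ! i) [0..<d ! 0]"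


lemma frame_map_index:
  assumes F: "set F \<subseteq> carrier_vec k" and f: "f \<in> carrier_vec k" and r: "r < k"
  shows "frame_map k F f $ r = (\<Sum>i<length F. (\<Sum>c<k. f $ c * cnj (F ! i $ c)) * F ! i $ r)"
proof -
  have Fi: "F ! i \<in> carrier_vec k" if "i < length F" for i
    using F that nth_mem by blast
  have "frame_map k F f $ r = (\<Sum>i<length F. ((f \<bullet>c (F ! i)) \<cdot>\<^sub>v (F ! i)) $ r)"
    unfolding frame_map_def using Fi r by (subst index_finsum_vec) auto
  also have "\<dots> = (\<Sum>i<length F. (\<Sum>c<k. f $ c * cnj (F ! i $ c)) * F ! i $ r)"
  proof (rule sum.cong)
    fix i assume "i \<in> {..<length F}"
    then have "F ! i \<in> carrier_vec k" using Fi by auto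
    then show "((f \<bullet>c (F ! i)) \<cdot>\<^sub>v (F ! i)) $ r = (\<Sum>c<k. f $ c * cnj (F ! i $ c)) * F ! i $ r"
      using r by (auto simp: scalar_prod_def atLeast0LessThan)
  qed simp
  finally show ?thesis .
qed

lemma frame_map_carrier:
  assumes "set F \<subseteq> carrier_vec k"
  shows "frame_map k F f \<in> carrier_vec k"
proof -
  have "F ! i \<in> carrier_vec k" if "i < length F" for i
    using assms that nth_mem by blast
  then show ?thesis unfolding frame_map_def by (intro finsum_vec_closed) auto
qed

lemma frame_operator_carrier: "frame_operator k F \<in> carrier_mat k k"
  unfolding frame_operator_def by (auto simp: mat_of_cols_def)

lemma frame_operator_index:
  assumes F: "set F \<subseteq> carrier_vec k" and r: "r < k" and c: "c < k"
  shows "frame_operator k F $$ (r, c) = (\<Sum>i<length F. F ! i $ r * cnj (F ! i $ c))"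
proof -
  have "frame_operator k F $$ (r, c) = frame_map k F (unit_vec k c) $ r"
    unfolding frame_operator_def using r c by (simp add: mat_of_cols_index)
  also have "\<dots> = (\<Sum>i<length F. (\<Sum>b<k. unit_vec k c $ b * cnj (F ! i $ b)) * F ! i $ r)"
    by (rule frame_map_index[OF F _ r]) simp
  also have "\<dots> = (\<Sum>i<length F. F ! i $ r * cnj (F ! i $ c))"
  proof (rule sum.cong)
    fix i
    have "(\<Sum>b<k. unit_vec k c $ b * cnj (F ! i $ b)) = (\<Sum>b<k. if b = c then cnj (F ! i $ b) else 0)"
      using c by (intro sum.cong) auto
    also have "\<dots> = cnj (F ! i $ c)" using c by simp
    finally show "(\<Sum>b<k. unit_vec k c $ b * cnj (F ! i $ b)) * F ! i $ r = F ! i $ r * cnj (F ! i $ c)"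
      by simp
  qed simp
  finally show ?thesis .
qed

lemma frame_operator_mult_vec:
  assumes F: "set F \<subseteq> carrier_vec k" and f: "f \<in> carrier_vec k"
  shows "frame_operator k F *\<^sub>v f = frame_map k F f"
proof (rule eq_vecI)
  note S = frame_operator_carrier[of k F]
  show "dim_vec (frame_operator k F *\<^sub>v f) = dim_vec (frame_map k F f)"
    using S frame_map_carrier[OF F, of f] by auto
  fix r assume "r < dim_vec (frame_map k F f)"
  then have r: "r < k" using frame_map_carrier[OF F, of f] by auto
  have "(frame_operator k F *\<^sub>v f) $ r = (\<Sum>c<k. frame_operator k F $$ (r, c) * f $ c)"
    using S f r by (auto simp: scalar_prod_def atLeast0LessThan)
  also have "\<dots> = (\<Sum>c<k. \<Sum>i<length F. F ! i $ r * cnj (F ! i $ c) * f $ c)"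
    by (simp add: frame_operator_index[OF F r] sum_distrib_right)
  also have "\<dots> = (\<Sum>i<length F. \<Sum>c<k. F ! i $ r * cnj (F ! i $ c) * f $ c)"
    by (rule sum.swap)
  also have "\<dots> = frame_map k F f $ r"
    unfolding frame_map_index[OF F f r] by (simp add: sum_distrib_left sum_distrib_right mult_ac)
  finally show "(frame_operator k F *\<^sub>v f) $ r = frame_map k F f $ r" .
qed

lemma eigenvalue_vector_eq:
  assumes "char_poly A = (\<Prod>a\<leftarrow>xs. [:- complex_of_real a, 1:])" and "sorted_wrt (\<ge>) xs"
  shows "eigenvalue_vector A = xs"
proof -
  have "proots (\<Prod>a\<leftarrow>xs. [:- complex_of_real a, 1:]) = mset (map complex_of_real xs)" for xs
  proof (induction xs)
    case (Cons a xs)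
    have "(\<Prod>a\<leftarrow>xs. [:- complex_of_real a, 1:]) \<noteq> 0"
      by (auto simp: prod_list_zero_iff)
    then show ?case using Cons by (simp add: proots_mult del: mult_pCons_left)
  qed simp
  then have "image_mset Re (proots (char_poly A)) = mset xs"
    unfolding assms(1) by (simp add: multiset.map_comp o_def)
  moreover have "sorted (rev xs)" using assms(2) by (simp add: sorted_wrt_rev)
  then have "sort xs = rev xs" by (metis mset_rev properties_for_sort)
  ultimately show ?thesis
    unfolding eigenvalue_vector_def by (simp add: sorted_list_of_multiset_mset)
qed

end

theory Submission
  imports Defs
begin

text \<open>Write the \<open>n\<close> vectors of each member of a design as the columns of a matrix. The frame
operator is the Gram matrix of its rows, and the design condition prescribes the total energy of
the \<open>i\<close>-th columns, summed over all members.

Necessity reduces to a single member. In an eigenbasis of the frame operator the rows are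
orthogonal and their squared lengths are the eigenvalues (\<open>frame_in_eigenbasis\<close>, by the
spectral theorem \<open>hermitian_unitary_diagonalization\<close>). The energy of any \<open>l\<close> columns then
weighs the eigenvalues with factors that are at most \<open>1\<close> and, by Bessel's inequality, add up
to at most \<open>l\<close>; hence it is at most the sum of the \<open>l\<close> largest eigenvalues
(\<open>column_energies_le_largest\<close>). Since all spectra are decreasing, the \<open>l\<close>-th partial sum
of \<open>\<sigma>\<close> is the sum of these bounds over the members.

For sufficiency, the diagonal matrices with entries \<open>sqrt (\<mu> j r)\<close> have the required frame
operators, and their column energies add up to \<open>\<sigma>\<close>, the sum of the padded spectra.
Rotating columns \<open>p\<close> and \<open>q\<close> of all members by one common angle keeps all frame operators,
and by the intermediate value theorem it can transfer any amount of energy from the stronger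
column to the weaker one, up to the difference of their energies (\<open>rotate_columns\<close>).
Finitely many such transfers turn \<open>\<sigma>\<close> into any decreasing vector that it majorizes
(\<open>majorization_reached_by_transfers\<close>).\<close>

section \<open>Majorization\<close>

text \<open>The Hardy--Littlewood--Polya reduction in the form needed here: a property that survives moving
an amount \<open>t\<close> from one coordinate to a smaller one, as long as \<open>t\<close> does not exceed their
difference, passes from \<open>y\<close> to every decreasing vector that \<open>y\<close> majorizes. Each move makes one
more coordinate agree with the target. The intermediate vectors stay comparable with the target
because the amount moves to a later coordinate and the prefix sums are taken in the given order.\<close>

lemma majorization_reached_by_transfers:
  fixes x y :: "nat \<Rightarrow> real"
  assumes decreasing: "\<And>i j. i \<le> j \<Longrightarrow> j < n \<Longrightarrow> x j \<le> x i"
    and prefix: "\<And>l. l \<le> n \<Longrightarrow> sum x {..<l} \<le> sum y {..<l}"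
    and total: "sum x {..<n} = sum y {..<n}"
    and start: "P y"
    and transfer: "\<And>y p q t. P y \<Longrightarrow> p < n \<Longrightarrow> q < n \<Longrightarrow> p \<noteq> q \<Longrightarrow> 0 \<le> t \<Longrightarrow> t \<le> y p - y q
      \<Longrightarrow> P (y(p := y p - t, q := y q + t))"
  shows "\<exists>z. P z \<and> (\<forall>i<n. z i = x i)"
  using prefix total start
proof (induction "card {i. i < n \<and> x i \<noteq> y i}" arbitrary: y rule: less_induct)
  case less
  show ?case
  proof (cases "\<exists>k<n. y k < x k")
    case False
    have "sum (\<lambda>i. y i - x i) {..<n} = 0" using less.prems(2) by (simp add: sum_subtractf)
    moreover have "0 \<le> y i - x i" if "i \<in> {..<n}" for i
      using False that by (metis diff_ge_0_iff_ge lessThan_iff not_less)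
    ultimately have "\<forall>i\<in>{..<n}. y i - x i = 0"
      using sum_nonneg_eq_0_iff[of "{..<n}" "\<lambda>i. y i - x i"] by blast
    then show ?thesis using less.prems(3) by (intro exI[of _ y]) auto
  next
    case True
    \<comment> \<open>The first coordinate that must grow; the prefix sum through it forces a coordinate before it that must shrink.\<close>
    define k where "k = (LEAST k. k < n \<and> y k < x k)"
    have k: "k < n" "y k < x k" unfolding k_def using LeastI_ex[OF True[unfolded]] by auto
    have before: "x i \<le> y i" if "i < k" for i
      using not_less_Least[OF that[unfolded k_def]] that k(1) by auto
    have "\<exists>j<k. x j < y j"
    proof (rule ccontr)
      assume "\<not> (\<exists>j<k. x j < y j)"
      then have "sum y {..<k} \<le> sum x {..<k}" by (intro sum_mono) (metis lessThan_iff not_less)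
      then have "sum y {..<Suc k} < sum x {..<Suc k}" using k(2) by simp
      with less.prems(1)[of "Suc k"] k(1) show False by simp
    qed
    then obtain j where j: "j < k" "x j < y j" by blast
    \<comment> \<open>The largest amount that overshoots neither target value, so that one of them is reached.\<close>
    define t where "t = min (y j - x j) (x k - y k)"
    define z where "z = y(j := y j - t, k := y k + t)"
    have t: "0 < t" "t \<le> y j - x j" "t \<le> x k - y k" using j k by (auto simp: t_def)
    have "x k \<le> x j" using decreasing j(1) k(1) by simp
    then have "t \<le> y j - y k" using t by linarith
    then have "P z" unfolding z_def using less.prems(3) j(1) k(1) t(1) by (intro transfer) auto
    have sum_z: "sum z {..<l} = sum y {..<l} - (if j < l then t else 0) + (if k < l then t else 0)" for l
      unfolding z_def using j(1) by (induction l) (auto)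
    \<comment> \<open>Up to \<open>k\<close> the vector \<open>z\<close> still dominates \<open>x\<close> coordinatewise; beyond \<open>k\<close> the prefix sums of \<open>y\<close> are unchanged.\<close>
    have pre: "sum x {..<l} \<le> sum z {..<l}" if "l \<le> n" for l
    proof (cases "l \<le> k")
      case True
      have "x i \<le> z i" if "i < l" for i
        using that True before[of i] t(2) by (auto simp: z_def)
      then show ?thesis by (intro sum_mono) auto
    next
      case False
      then show ?thesis using sum_z[of l] less.prems(1)[OF that] j(1) by simp
    qed
    have tot: "sum x {..<n} = sum z {..<n}" using sum_z[of n] less.prems(2) j(1) k(1) by simp
    have "{i. i < n \<and> x i \<noteq> z i} \<subset> {i. i < n \<and> x i \<noteq> y i}"
    proof
      show "{i. i < n \<and> x i \<noteq> z i} \<subseteq> {i. i < n \<and> x i \<noteq> y i}"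
        using j k by (auto simp: z_def split: if_splits)
      have "z j = x j \<or> z k = x k" using j(1) by (auto simp: z_def t_def min_def)
      then have "j \<notin> {i. i < n \<and> x i \<noteq> z i} \<or> k \<notin> {i. i < n \<and> x i \<noteq> z i}" by auto
      moreover have "j \<in> {i. i < n \<and> x i \<noteq> y i}" "k \<in> {i. i < n \<and> x i \<noteq> y i}"
        using j k by auto
      ultimately show "{i. i < n \<and> x i \<noteq> z i} \<noteq> {i. i < n \<and> x i \<noteq> y i}" by blast
    qed
    then have "card {i. i < n \<and> x i \<noteq> z i} < card {i. i < n \<and> x i \<noteq> y i}"
      by (intro psubset_card_mono) auto
    from less.hyps[OF this pre tot \<open>P z\<close>] show ?thesis by simp
  qed
qed

lemma nth_decreasing:
  "sorted_wrt (\<ge>) (xs :: 'a :: linorder list) \<Longrightarrow> i \<le> j \<Longrightarrow> j < length xs \<Longrightarrow> xs ! j \<le> xs ! i"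
  by (cases "i = j") (auto simp: sorted_wrt_iff_nth_less)

lemma zero_pad_nth: "i < k \<Longrightarrow> zero_pad k x ! i = (if i < length x then x ! i else 0)"
  by (auto simp: zero_pad_def nth_append)

lemma decreasing_rearrangement_sorted:
  assumes "sorted_wrt (\<ge>) x"
  shows "decreasing_rearrangement x = x"
proof -
  have "sorted (rev x)" using assms by (simp add: sorted_wrt_rev)
  then have "sort x = rev x" by (metis mset_rev properties_for_sort)
  then show ?thesis by (simp add: decreasing_rearrangement_def)
qed

lemma majorized_by_sorted:
  assumes x: "length x = n" "sorted_wrt (\<ge>) x"
    and y: "length y \<le> n" "sorted_wrt (\<ge>) y" "\<forall>v\<in>set y. 0 \<le> v"
  shows "x \<prec> y \<longleftrightarrow> (\<forall>l\<le>n. (\<Sum>i<l. x ! i) \<le> (\<Sum>i<l. zero_pad n y ! i))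
    \<and> (\<Sum>i<n. x ! i) = (\<Sum>i<n. zero_pad n y ! i)"
proof -
  have "sorted_wrt (\<ge>) (replicate (n - length y) (0 :: real))"
    by (simp add: sorted_wrt_iff_nth_less)
  then have "sorted_wrt (\<ge>) (zero_pad n y)"
    using y(2,3) by (auto simp: zero_pad_def sorted_wrt_append)
  then have "decreasing_rearrangement (zero_pad n y) = zero_pad n y"
    by (rule decreasing_rearrangement_sorted)
  moreover have "decreasing_rearrangement (zero_pad n x) = x"
    using decreasing_rearrangement_sorted[OF x(2)] x(1) by (simp add: zero_pad_def)
  moreover have "(\<forall>l\<in>{1..n}. P l) \<longleftrightarrow> (\<forall>l\<le>n. P l)" if "P 0" for P :: "nat \<Rightarrow> bool"
    using that by (metis atLeastAtMost_iff less_one linorder_not_less)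
  ultimately show ?thesis
    using x(1) y(1) unfolding majorized_by_def by (simp add: Let_def max_absorb1)
qed

section \<open>Rotations of columns\<close>

text \<open>A family of \<open>n\<close> vectors is stored as \<open>g i a\<close>, with \<open>i\<close> the number of the vector and \<open>a\<close>
the coordinate: a matrix whose columns are the vectors. The Gram matrix of its rows is then the
frame operator. Coordinates range over an arbitrary type, so that all members of a design can be
stacked into one matrix indexed by pairs \<open>(j, r)\<close>.\<close>

definition row_gram :: "nat \<Rightarrow> (nat \<Rightarrow> 'k \<Rightarrow> complex) \<Rightarrow> 'k \<Rightarrow> 'k \<Rightarrow> complex" where
  "row_gram n g a b = (\<Sum>i<n. g i a * cnj (g i b))"

definition column_energy :: "'k set \<Rightarrow> (nat \<Rightarrow> 'k \<Rightarrow> complex) \<Rightarrow> nat \<Rightarrow> real" where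
  "column_energy K g i = (\<Sum>a\<in>K. (cmod (g i a))\<^sup>2)"

text \<open>Rotating two columns is multiplication by a unitary matrix from the right and therefore does not
change the Gram matrix of the rows. The rotation by a quarter turn exchanges the energies of the
two columns, so by continuity every intermediate distribution of their total energy occurs at
some angle. Since all rows are rotated at once, this acts on all members of a design
simultaneously.\<close>

lemma rotate_columns:
  fixes g :: "nat \<Rightarrow> 'k \<Rightarrow> complex"
  assumes p: "p < n" and q: "q < n" and "p \<noteq> q"
    and t: "0 \<le> t" "t \<le> column_energy K g p - column_energy K g q"
  shows "\<exists>h. row_gram n h = row_gram n g
    \<and> column_energy K h = (column_energy K g)(p := column_energy K g p - t, q := column_energy K g q + t)"
proof -
  define E where "E \<theta> = (\<Sum>a\<in>K. (cmod (of_real (cos \<theta>) * g p a + of_real (sin \<theta>) * g q a))\<^sup>2)" for \<theta>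
  have "continuous_on {0..pi/2} E" unfolding E_def by (intro continuous_intros)
  moreover have "E (pi/2) = column_energy K g q" "E 0 = column_energy K g p"
    by (simp_all add: E_def column_energy_def)
  ultimately obtain \<theta> where \<theta>: "E \<theta> = column_energy K g p - t"
    using IVT2'[of E "pi/2" "column_energy K g p - t" 0] t pi_ge_zero by fastforce
  define c s where "c = complex_of_real (cos \<theta>)" and "s = complex_of_real (sin \<theta>)"
  have cs: "c * c + s * s = 1" "cnj c = c" "cnj s = s"
    using sin_cos_squared_add3[of \<theta>] unfolding c_def s_def
    by (simp_all flip: of_real_mult of_real_add)
  define h where "h i a = (if i = p then c * g p a + s * g q a
    else if i = q then - s * g p a + c * g q a else g i a)" for i a
  \<comment> \<open>The rotation matrix is orthogonal, hence it preserves the contribution of the two columns to the Gram matrix.\<close>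
  have pair: "h p a * cnj (h p b) + h q a * cnj (h q b) = g p a * cnj (g p b) + g q a * cnj (g q b)" for a b
  proof -
    have "h p a * cnj (h p b) + h q a * cnj (h q b)
        = (c * c + s * s) * (g p a * cnj (g p b) + g q a * cnj (g q b))"
      using \<open>p \<noteq> q\<close> by (simp add: h_def cs(2,3) algebra_simps)
    then show ?thesis by (simp add: cs(1))
  qed
  have "row_gram n h a b = row_gram n g a b" for a b
  proof -
    have split: "row_gram n f a b = (f p a * cnj (f p b) + f q a * cnj (f q b))
        + (\<Sum>i\<in>{..<n} - {p, q}. f i a * cnj (f i b))" for f :: "nat \<Rightarrow> 'k \<Rightarrow> complex"
      unfolding row_gram_def using sum.subset_diff[of "{p, q}" "{..<n}" "\<lambda>i. f i a * cnj (f i b)"] p q \<open>p \<noteq> q\<close>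
      by (simp add: add.commute)
    have "(\<Sum>i\<in>{..<n} - {p, q}. h i a * cnj (h i b)) = (\<Sum>i\<in>{..<n} - {p, q}. g i a * cnj (g i b))"
      by (intro sum.cong) (auto simp: h_def)
    then show ?thesis using split[of h] split[of g] pair by simp
  qed
  moreover have "column_energy K h i
      = ((column_energy K g)(p := column_energy K g p - t, q := column_energy K g q + t)) i" for i
  proof -
    have hp: "column_energy K h p = column_energy K g p - t"
      using \<theta> by (simp add: column_energy_def h_def E_def c_def s_def)
    have "(cmod (h p a))\<^sup>2 + (cmod (h q a))\<^sup>2 = (cmod (g p a))\<^sup>2 + (cmod (g q a))\<^sup>2" for a
      using arg_cong[OF pair[of a a], of Re] by (simp add: complex_mult_cnj cmod_power2)
    then have "(\<Sum>a\<in>K. (cmod (h p a))\<^sup>2 + (cmod (h q a))\<^sup>2) = (\<Sum>a\<in>K. (cmod (g p a))\<^sup>2 + (cmod (g q a))\<^sup>2)"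
      by simp
    then have "column_energy K h p + column_energy K h q = column_energy K g p + column_energy K g q"
      unfolding column_energy_def by (simp add: sum.distrib)
    then have hq: "column_energy K h q = column_energy K g q + t" using hp by simp
    have "column_energy K h i = column_energy K g i" if "i \<noteq> p" "i \<noteq> q"
      using that by (simp add: column_energy_def h_def)
    then show ?thesis using hp hq by simp
  qed
  ultimately show ?thesis by blast
qed

section \<open>Columns of a matrix with orthogonal rows\<close>

text \<open>Weights between \<open>0\<close> and \<open>1\<close> of total at most \<open>l\<close> do best when they are concentrated on the
\<open>l\<close> largest values: comparing with the indicator \<open>\<chi>\<close> of these, the factors \<open>e r - e l\<close> and
\<open>w r - \<chi> r\<close> have opposite signs or vanish.\<close>

lemma weighted_sum_le_largest:
  fixes e w :: "nat \<Rightarrow> real"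
  assumes decreasing: "\<And>r s. r \<le> s \<Longrightarrow> s < k \<Longrightarrow> e s \<le> e r" and nonneg: "\<And>r. r < k \<Longrightarrow> 0 \<le> e r"
    and w: "\<And>r. r < k \<Longrightarrow> 0 \<le> w r" "\<And>r. r < k \<Longrightarrow> w r \<le> 1" and total: "(\<Sum>r<k. w r) \<le> real l"
  shows "(\<Sum>r<k. e r * w r) \<le> (\<Sum>r<l. if r < k then e r else 0)"
proof (cases "k \<le> l")
  case True
  have "(\<Sum>r<k. e r * w r) \<le> (\<Sum>r<k. e r)"
    using w nonneg by (intro sum_mono) (auto intro: mult_left_le)
  also have "\<dots> = (\<Sum>r<l. if r < k then e r else 0)"
    using True by (intro sum.mono_neutral_cong_left) auto
  finally show ?thesis .
next
  case False
  define \<chi> where "\<chi> r = (if r < l then 1 else 0 :: real)" for r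
  have "(e r - e l) * (w r - \<chi> r) \<le> 0" if "r < k" for r
    using decreasing[of r l] decreasing[of l r] w(1)[OF that] w(2)[OF that] that False
    by (auto simp: \<chi>_def mult_le_0_iff)
  then have "(\<Sum>r<k. (e r - e l) * (w r - \<chi> r)) \<le> 0" by (intro sum_nonpos) auto
  then have "(\<Sum>r<k. e r * w r) \<le> (\<Sum>r<k. e r * \<chi> r) + e l * ((\<Sum>r<k. w r) - (\<Sum>r<k. \<chi> r))"
    by (simp add: algebra_simps sum.distrib sum_subtractf sum_distrib_left)
  moreover have "(\<Sum>r<k. \<chi> r) = (\<Sum>r<l. 1)" "(\<Sum>r<k. e r * \<chi> r) = (\<Sum>r<l. if r < k then e r else 0)"
    unfolding \<chi>_def using False by (intro sum.mono_neutral_cong_right; auto split: if_splits)+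
  moreover have "e l * ((\<Sum>r<k. w r) - real l) \<le> 0"
    using False nonneg[of l] total by (simp add: mult_le_0_iff)
  ultimately show ?thesis by simp
qed

text \<open>Bessel's inequality for the \<open>i\<close>-th standard unit vector and the normalized rows: \<open>x\<close> is the
projection of that vector to the span of the rows and \<open>B\<close> its squared length, which is also
its \<open>i\<close>-th coordinate, so \<open>B\<^sup>2 \<le> B\<close>. A row with \<open>e r = 0\<close> vanishes, and
division by zero gives it the correct coefficient \<open>0\<close>.\<close>

lemma bessel_orthogonal_rows:
  fixes g :: "nat \<Rightarrow> nat \<Rightarrow> complex" and e :: "nat \<Rightarrow> real"
  assumes gram: "\<And>r s. r < k \<Longrightarrow> s < k \<Longrightarrow> row_gram n g r s = (if r = s then of_real (e r) else 0)"
    and i: "i < n"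
  shows "(\<Sum>r<k. (cmod (g i r))\<^sup>2 / e r) \<le> 1"
proof -
  define B where "B = (\<Sum>r<k. (cmod (g i r))\<^sup>2 / e r)"
  define c where "c r = cnj (g i r) / of_real (e r)" for r
  define x where "x t = (\<Sum>r<k. c r * g t r)" for t
  have "x i = of_real B"
    unfolding x_def B_def c_def of_real_sum
    by (intro sum.cong) (auto simp: complex_norm_square mult.commute simp del: of_real_power)
  have "(\<Sum>t<n. x t * cnj (x t)) = (\<Sum>t<n. \<Sum>r<k. \<Sum>s<k. c r * cnj (c s) * (g t r * cnj (g t s)))"
    by (simp add: x_def cnj_sum sum_product mult_ac)
  also have "\<dots> = (\<Sum>r<k. \<Sum>s<k. \<Sum>t<n. c r * cnj (c s) * (g t r * cnj (g t s)))"
    by (subst sum.swap, rule sum.cong, simp, rule sum.swap)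
  also have "\<dots> = (\<Sum>r<k. \<Sum>s<k. c r * cnj (c s) * row_gram n g r s)"
    by (simp add: row_gram_def sum_distrib_left)
  also have "\<dots> = (\<Sum>r<k. \<Sum>s<k. if s = r then c r * cnj (c r) * of_real (e r) else 0)"
    by (intro sum.cong) (auto simp: gram)
  also have "\<dots> = (\<Sum>r<k. c r * cnj (c r) * of_real (e r))" by simp
  also have "\<dots> = of_real B"
    unfolding B_def c_def of_real_sum
    by (intro sum.cong) (auto simp: complex_norm_square mult.commute simp del: of_real_power)
  finally have "complex_of_real (\<Sum>t<n. (cmod (x t))\<^sup>2) = of_real B"
    by (simp add: complex_norm_square del: of_real_power)
  then have "(\<Sum>t<n. (cmod (x t))\<^sup>2) = B" by (simp only: of_real_eq_iff)
  moreover have "(cmod (x i))\<^sup>2 \<le> (\<Sum>t<n. (cmod (x t))\<^sup>2)"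
    using i by (intro member_le_sum) auto
  ultimately have "B * B \<le> B * 1" using \<open>x i = of_real B\<close> by (simp add: power2_eq_square)
  then have "B \<le> 1" by (cases "B > 0") auto
  then show ?thesis by (simp add: B_def)
qed

lemma row_gram_diagonal: "row_gram n g a a = of_real (\<Sum>i<n. (cmod (g i a))\<^sup>2)"
  unfolding row_gram_def of_real_sum by (intro sum.cong) (auto simp: complex_norm_square simp del: of_real_power)

text \<open>Ky Fan's inequality. The energy of the first \<open>l\<close> columns is a weighted sum of the row
energies \<open>e r\<close>, where \<open>w r\<close> is the fraction of row \<open>r\<close> that lies in these columns. The
fractions are at most \<open>1\<close>, and Bessel's inequality in each column bounds their total by \<open>l\<close>.\<close>

lemma column_energies_le_largest:
  fixes g :: "nat \<Rightarrow> nat \<Rightarrow> complex" and e :: "nat \<Rightarrow> real"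
  assumes gram: "\<And>r s. r < k \<Longrightarrow> s < k \<Longrightarrow> row_gram n g r s = (if r = s then of_real (e r) else 0)"
    and decreasing: "\<And>r s. r \<le> s \<Longrightarrow> s < k \<Longrightarrow> e s \<le> e r"
    and l: "l \<le> n"
  shows "(\<Sum>i<l. column_energy {..<k} g i) \<le> (\<Sum>r<l. if r < k then e r else 0)"
proof -
  have row: "(\<Sum>i<n. (cmod (g i r))\<^sup>2) = e r" if "r < k" for r
    using gram[OF that that] unfolding row_gram_diagonal by (simp only: of_real_eq_iff simp_thms if_True)
  have e0: "0 \<le> e r" if "r < k" for r using row[OF that] sum_nonneg[of "{..<n}" "\<lambda>i. (cmod (g i r))\<^sup>2"] by simp
  define w where "w r = (\<Sum>i<l. (cmod (g i r))\<^sup>2) / e r" for r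
  have partial: "(\<Sum>i<l. (cmod (g i r))\<^sup>2) \<le> e r" if "r < k" for r
    using row[OF that] l sum_mono2[of "{..<n}" "{..<l}" "\<lambda>i. (cmod (g i r))\<^sup>2"] by auto
  have "(\<Sum>i<l. column_energy {..<k} g i) = (\<Sum>r<k. \<Sum>i<l. (cmod (g i r))\<^sup>2)"
    unfolding column_energy_def by (rule sum.swap)
  also have "\<dots> = (\<Sum>r<k. e r * w r)"
  proof (rule sum.cong)
    fix r assume "r \<in> {..<k}"
    then have "0 \<le> (\<Sum>i<l. (cmod (g i r))\<^sup>2)" "(\<Sum>i<l. (cmod (g i r))\<^sup>2) \<le> e r"
      using partial by (auto intro: sum_nonneg)
    then show "(\<Sum>i<l. (cmod (g i r))\<^sup>2) = e r * w r" by (auto simp: w_def)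
  qed simp
  also have "\<dots> \<le> (\<Sum>r<l. if r < k then e r else 0)"
  proof (rule weighted_sum_le_largest[OF decreasing e0])
    fix r assume r: "r < k"
    show "0 \<le> w r" using e0[OF r] by (auto simp: w_def intro!: divide_nonneg_nonneg sum_nonneg)
    show "w r \<le> 1" using partial[OF r] e0[OF r] by (auto simp: w_def divide_le_eq_1)
  next
    have "(\<Sum>r<k. w r) = (\<Sum>i<l. \<Sum>r<k. (cmod (g i r))\<^sup>2 / e r)"
      unfolding w_def sum_divide_distrib by (rule sum.swap)
    also have "\<dots> \<le> (\<Sum>i<l. 1)" using l by (intro sum_mono bessel_orthogonal_rows[OF gram]) auto
    finally show "(\<Sum>r<k. w r) \<le> real l" by simp
  qed auto
  finally show ?thesis .
qed

section \<open>Unitary diagonalization of Hermitian matrices\<close>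

lemma mat_adjoint_index [simp]:
  "i < dim_col A \<Longrightarrow> j < dim_row A \<Longrightarrow> mat_adjoint (A :: complex mat) $$ (i, j) = cnj (A $$ (j, i))"
  by (simp add: mat_adjoint_def mat_of_rows_index)

lemma mat_adjoint_dim [simp]: "dim_row (mat_adjoint A) = dim_col A" "dim_col (mat_adjoint A) = dim_row A"
  by (simp_all add: mat_adjoint_def)

lemma mat_adjoint_carrier [simp]: "A \<in> carrier_mat r c \<Longrightarrow> mat_adjoint A \<in> carrier_mat c r"
  by (rule carrier_matI) simp_all

lemma square_mult_carrier [simp]:
  "A \<in> carrier_mat n n \<Longrightarrow> B \<in> carrier_mat n n \<Longrightarrow> A * B \<in> carrier_mat n n"
  by (rule mult_carrier_mat)

lemma mat_adjoint_mult:
  assumes A: "(A :: complex mat) \<in> carrier_mat r k" and B: "B \<in> carrier_mat k c"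
  shows "mat_adjoint (A * B) = mat_adjoint B * mat_adjoint A"
proof (rule eq_matI)
  fix i j assume "i < dim_row (mat_adjoint B * mat_adjoint A)" "j < dim_col (mat_adjoint B * mat_adjoint A)"
  then have ij: "i < c" "j < r" using A B by auto
  have "mat_adjoint (A * B) $$ (i, j) = (\<Sum>t<k. cnj (A $$ (j, t)) * cnj (B $$ (t, i)))"
    using A B ij by (simp add: scalar_prod_def atLeast0LessThan)
  also have "\<dots> = (\<Sum>t<k. cnj (B $$ (t, i)) * cnj (A $$ (j, t)))"
    by (intro sum.cong refl) (rule mult.commute)
  also have "\<dots> = (mat_adjoint B * mat_adjoint A) $$ (i, j)"
    using A B ij by (simp add: scalar_prod_def atLeast0LessThan)
  finally show "mat_adjoint (A * B) $$ (i, j) = (mat_adjoint B * mat_adjoint A) $$ (i, j)" .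
qed (use A B in auto)

lemma mat_adjoint_involution [simp]: "mat_adjoint (mat_adjoint A) = (A :: complex mat)"
  by (intro eq_matI) auto

lemma mat_adjoint_one [simp]: "mat_adjoint (1\<^sub>m n) = (1\<^sub>m n :: complex mat)"
  by (intro eq_matI) auto

lemma mat_adjoint_block_diagonal:
  assumes A: "(A :: complex mat) \<in> carrier_mat a a" and D: "D \<in> carrier_mat b b"
  shows "mat_adjoint (four_block_mat A (0\<^sub>m a b) (0\<^sub>m b a) D)
    = four_block_mat (mat_adjoint A) (0\<^sub>m a b) (0\<^sub>m b a) (mat_adjoint D)"
  using A D by (intro eq_matI) auto

lemma block_diagonal_mult:
  assumes A: "(A :: complex mat) \<in> carrier_mat a a" and A': "A' \<in> carrier_mat a a"
    and D: "D \<in> carrier_mat b b" and D': "D' \<in> carrier_mat b b"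
  shows "four_block_mat A (0\<^sub>m a b) (0\<^sub>m b a) D * four_block_mat A' (0\<^sub>m a b) (0\<^sub>m b a) D'
    = four_block_mat (A * A') (0\<^sub>m a b) (0\<^sub>m b a) (D * D')"
proof -
  have "A * A' \<in> carrier_mat a a" "D * D' \<in> carrier_mat b b" using assms by auto
  then show ?thesis
    using mult_four_block_mat[OF A zero_carrier_mat zero_carrier_mat D A' zero_carrier_mat zero_carrier_mat D'] assms
    by simp
qed

text \<open>Gram--Schmidt orthogonalization of a basis that starts with \<open>v\<close>, followed by normalization.\<close>

lemma unitary_with_first_column:
  assumes v: "(v :: complex vec) \<in> carrier_vec n" and v0: "v \<noteq> 0\<^sub>v n"
  shows "\<exists>W c. W \<in> carrier_mat n n \<and> mat_adjoint W * W = 1\<^sub>m n \<and> col W 0 = c \<cdot>\<^sub>v v"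
proof -
  interpret cof_vec_space n "TYPE(complex)" .
  define b where "b = basis_completion v"
  define ws where "ws = gram_schmidt n b"
  note b = basis_completion[OF v v0, folded b_def]
  have n: "n \<noteq> 0" using v v0 by auto
  obtain vs where bv: "b = v # vs" using b(6,7) n by (cases b) auto
  have ws: "set ws \<subseteq> carrier_vec n" "corthogonal ws" "length ws = n"
    using gram_schmidt_result[OF b(2,4,5) refl, folded ws_def] b(6) by auto
  have hd: "ws ! 0 = v"
    using gram_schmidt_hd[OF v, of vs, folded bv] ws(3) n hd_conv_nth[of ws] unfolding ws_def by fastforce
  have wsc: "ws ! j \<in> carrier_vec n" if "j < n" for j using ws(1,3) that by (auto dest: nth_mem)
  define N where "N j = complex_of_real (sqrt (Re (ws ! j \<bullet>c ws ! j)))" for j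
  have N: "N j * N j = ws ! j \<bullet>c ws ! j" "N j \<noteq> 0" if "j < n" for j
  proof -
    have pos: "0 < ws ! j \<bullet>c ws ! j"
      using conjugate_square_greater_0_vec[OF wsc[OF that]] corthogonalD[OF ws(2), of j j] ws(3) that wsc[OF that] by auto
    then have re: "0 < Re (ws ! j \<bullet>c ws ! j)" "Im (ws ! j \<bullet>c ws ! j) = 0" by (auto simp: less_complex_def)
    show "N j * N j = ws ! j \<bullet>c ws ! j" using re
      by (simp add: N_def complex_eq_iff flip: of_real_mult)
    show "N j \<noteq> 0" using re by (simp add: N_def)
  qed
  define W where "W = mat n n (\<lambda>(i, j). ws ! j $ i / N j)"
  have W: "W \<in> carrier_mat n n" by (simp add: W_def)
  have "mat_adjoint W * W = 1\<^sub>m n"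
  proof (rule eq_matI)
    fix i j assume "i < dim_row (1\<^sub>m n :: complex mat)" "j < dim_col (1\<^sub>m n :: complex mat)"
    then have ij: "i < n" "j < n" by auto
    have "(mat_adjoint W * W) $$ (i, j) = (\<Sum>t<n. cnj (ws ! i $ t / N i) * (ws ! j $ t / N j))"
      using W ij by (simp add: scalar_prod_def atLeast0LessThan W_def)
    also have "\<dots> = (\<Sum>t<n. ws ! j $ t * cnj (ws ! i $ t)) / (N i * N j)"
      unfolding sum_divide_distrib by (intro sum.cong) (auto simp: N_def mult_ac)
    also have "(\<Sum>t<n. ws ! j $ t * cnj (ws ! i $ t)) = ws ! j \<bullet>c ws ! i"
      using wsc[OF ij(1)] wsc[OF ij(2)] by (simp add: scalar_prod_def atLeast0LessThan)
    also have "(ws ! j \<bullet>c ws ! i) / (N i * N j) = 1\<^sub>m n $$ (i, j)"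
      using corthogonalD[OF ws(2), of j i] ws(3) ij N[OF ij(1)] by (cases "i = j") auto
    finally show "(mat_adjoint W * W) $$ (i, j) = 1\<^sub>m n $$ (i, j)" .
  qed (use W in auto)
  moreover have "col W 0 = (1 / N 0) \<cdot>\<^sub>v v"
    using n hd v by (intro eq_vecI) (auto simp: W_def)
  ultimately show ?thesis using W by blast
qed

text \<open>In a unitary basis that starts with an eigenvector for \<open>e\<close>, the first column of \<open>A\<close> is
\<open>e\<close> times the first unit vector. The matrix stays Hermitian, so its first row has the same
form and an eigenvalue splits off.\<close>

lemma hermitian_deflation:
  assumes A: "(A :: complex mat) \<in> carrier_mat n n" and herm: "mat_adjoint A = A"
    and root: "poly (char_poly A) e = 0" and n: "n = Suc k"
  shows "\<exists>W B. W \<in> carrier_mat n n \<and> mat_adjoint W * W = 1\<^sub>m n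
    \<and> B \<in> carrier_mat k k \<and> mat_adjoint B = B
    \<and> mat_adjoint W * A * W = four_block_mat (mat 1 1 (\<lambda>_. e)) (0\<^sub>m 1 k) (0\<^sub>m k 1) B
    \<and> char_poly A = [:- e, 1:] * char_poly B"
proof -
  have "eigenvalue A e" unfolding eigenvalue_root_char_poly[OF A] using root .
  then obtain v where v: "v \<in> carrier_vec n" "v \<noteq> 0\<^sub>v n" "A *\<^sub>v v = e \<cdot>\<^sub>v v"
    using A unfolding eigenvalue_def eigenvector_def by auto
  obtain W c where W: "W \<in> carrier_mat n n" and WW: "mat_adjoint W * W = 1\<^sub>m n" and col: "col W 0 = c \<cdot>\<^sub>v v"
    using unitary_with_first_column[OF v(1,2)] by blast
  have W': "mat_adjoint W \<in> carrier_mat n n" using W by simp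
  have WW': "W * mat_adjoint W = 1\<^sub>m n" using mat_mult_left_right_inverse[OF W' W WW] .
  define A' where "A' = mat_adjoint W * A * W"
  have A': "A' \<in> carrier_mat n n" using A W W' by (simp add: A'_def)
  have herm': "mat_adjoint A' = A'"
    using A W W' herm by (simp add: A'_def mat_adjoint_mult[of _ n n _ n] assoc_mult_mat[of _ n n _ n _ n])
  have AW: "A * W \<in> carrier_mat n n" using A W by simp
  have "col A' 0 = col (mat_adjoint W * (A * W)) 0"
    unfolding A'_def using assoc_mult_mat[OF W' A W] by simp
  also have "\<dots> = mat_adjoint W *\<^sub>v (A *\<^sub>v col W 0)"
    using col_mult2[OF W' AW, of 0] col_mult2[OF A W, of 0] n by simp
  also have "A *\<^sub>v col W 0 = e \<cdot>\<^sub>v col W 0"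
    using A v by (simp add: col mult_mat_vec[of _ n n] smult_smult_assoc mult.commute)
  also have "mat_adjoint W *\<^sub>v (e \<cdot>\<^sub>v col W 0) = e \<cdot>\<^sub>v col (mat_adjoint W * W) 0"
    using W W' n by (subst mult_mat_vec[of _ n n]) (auto simp: col_mult2[of _ n n _ n] intro: carrier_vecI)
  finally have col0: "col A' 0 = e \<cdot>\<^sub>v unit_vec n 0" using n by (simp add: WW)
  have A'0: "A' $$ (i, 0) = (if i = 0 then e else 0)" if "i < n" for i
    using arg_cong[OF col0, of "\<lambda>v. v $ i"] A' that n by auto
  have A'0': "A' $$ (0, i) = (if i = 0 then e else 0)" if "i < n" for i
  proof (cases "i = 0")
    case False
    then show ?thesis
      using A'0[OF that] arg_cong[OF herm', of "\<lambda>M. M $$ (0, i)"] A' that n by simp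
  qed (use A'0 that in simp)
  define B where "B = mat k k (\<lambda>(i, j). A' $$ (Suc i, Suc j))"
  have B: "B \<in> carrier_mat k k" by (simp add: B_def)
  have hermB: "mat_adjoint B = B"
  proof (rule eq_matI)
    fix i j assume "i < dim_row B" "j < dim_col B"
    then show "mat_adjoint B $$ (i, j) = B $$ (i, j)"
      using arg_cong[OF herm', of "\<lambda>M. M $$ (Suc i, Suc j)"] A' n by (simp add: B_def)
  qed (auto simp: B_def)
  define E where "E = mat 1 1 (\<lambda>_. e)"
  have E: "E \<in> carrier_mat 1 1" by (simp add: E_def)
  have blocks: "A' = four_block_mat E (0\<^sub>m 1 k) (0\<^sub>m k 1) B"
  proof (rule eq_matI)
    fix i j assume "i < dim_row (four_block_mat E (0\<^sub>m 1 k) (0\<^sub>m k 1) B)"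
      "j < dim_col (four_block_mat E (0\<^sub>m 1 k) (0\<^sub>m k 1) B)"
    then have "i < n" "j < n" using n by (auto simp: E_def B_def)
    then show "A' $$ (i, j) = four_block_mat E (0\<^sub>m 1 k) (0\<^sub>m k 1) B $$ (i, j)"
      using A'0[of i] A'0'[of j] n by (cases i; cases j) (auto simp: E_def B_def)
  qed (use A' n in \<open>auto simp: E_def B_def\<close>)
  have "similar_mat A' A"
    using A A' W W' by (intro similar_matI[OF _ WW WW' A'_def]) simp
  then have "char_poly A = char_poly A'" by (rule char_poly_similar[symmetric])
  also have "\<dots> = char_poly E * char_poly B"
    unfolding blocks by (rule char_poly_four_block_zeros_col[OF E _ B]) simp
  also have "char_poly E = [:- e, 1:]"
    by (simp add: E_def char_poly_defs det_def sign_def)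
  finally have "char_poly A = [:- e, 1:] * char_poly B" .
  then show ?thesis using W WW B hermB blocks unfolding A'_def E_def by blast
qed

text \<open>The spectral theorem for Hermitian matrices, with the eigenvalues in any prescribed order; that
freedom allows the eigenbasis to be numbered by decreasing eigenvalues.\<close>

lemma hermitian_unitary_diagonalization:
  assumes "(A :: complex mat) \<in> carrier_mat n n" "mat_adjoint A = A"
    and "char_poly A = (\<Prod>a\<leftarrow>es. [:- a, 1:])"
  shows "\<exists>U \<in> carrier_mat n n. mat_adjoint U * U = 1\<^sub>m n
    \<and> mat_adjoint U * A * U = mat_diag n (\<lambda>r. es ! r)"
  using assms
proof (induction es arbitrary: n A)
  case Nil
  then have "n = 0" using degree_monic_char_poly[of A n] by auto
  then show ?case using Nil.prems(1) by (intro bexI[of _ "1\<^sub>m 0"]) (auto simp: mat_diag_def)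
next
  case (Cons e es)
  note A = Cons.prems(1) and herm = Cons.prems(2)
  have cp: "char_poly A = [:- e, 1:] * (\<Prod>a\<leftarrow>es. [:- a, 1:])" using Cons.prems(3) by simp
  have root: "poly (char_poly A) e = 0" unfolding cp by simp
  have "degree (char_poly A) = Suc (degree (\<Prod>a\<leftarrow>es. [:- a, 1:]))"
    unfolding cp by (subst degree_mult_eq) (auto simp: prod_list_zero_iff)
  then have "n \<noteq> 0" using degree_monic_char_poly[OF A] by simp
  then obtain k where n: "n = Suc k" by (cases n) auto
  define E where "E = mat 1 1 (\<lambda>_. e)"
  have E: "E \<in> carrier_mat 1 1" by (simp add: E_def)
  obtain W B where W: "W \<in> carrier_mat n n" and WW: "mat_adjoint W * W = 1\<^sub>m n"
    and B: "B \<in> carrier_mat k k" and hermB: "mat_adjoint B = B"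
    and blocks: "mat_adjoint W * A * W = four_block_mat E (0\<^sub>m 1 k) (0\<^sub>m k 1) B"
    and cpB: "char_poly A = [:- e, 1:] * char_poly B"
    using hermitian_deflation[OF A herm root n] unfolding E_def by blast
  have W': "mat_adjoint W \<in> carrier_mat n n" using W by simp
  define A' where "A' = mat_adjoint W * A * W"
  note blocks = blocks[folded A'_def]
  have "[:- e, 1:] \<noteq> 0" by simp
  then have "char_poly B = (\<Prod>a\<leftarrow>es. [:- a, 1:])"
    using cp cpB by (metis mult_cancel_left)
  from Cons.IH[OF B hermB this] obtain U where U: "U \<in> carrier_mat k k"
    and UU: "mat_adjoint U * U = 1\<^sub>m k" and diag: "mat_adjoint U * B * U = mat_diag k (\<lambda>r. es ! r)" by blast
  define V where "V = four_block_mat (1\<^sub>m 1) (0\<^sub>m 1 k) (0\<^sub>m k 1) U"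
  have U': "mat_adjoint U \<in> carrier_mat k k" using U by simp
  have one: "(1\<^sub>m 1 :: complex mat) \<in> carrier_mat 1 1" by simp
  have V: "V \<in> carrier_mat n n"
    using four_block_carrier_mat[OF one U] unfolding V_def n by simp
  have V': "mat_adjoint V = four_block_mat (1\<^sub>m 1) (0\<^sub>m 1 k) (0\<^sub>m k 1) (mat_adjoint U)"
    unfolding V_def using mat_adjoint_block_diagonal[OF one U] by simp
  have Vc: "mat_adjoint V \<in> carrier_mat n n" using V by simp
  have VV: "mat_adjoint V * V = 1\<^sub>m n"
  proof -
    have "mat_adjoint V * V = four_block_mat (1\<^sub>m 1) (0\<^sub>m 1 k) (0\<^sub>m k 1) (1\<^sub>m k)"
      unfolding V' unfolding V_def block_diagonal_mult[OF one one U' U] UU by simp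
    then show ?thesis unfolding n by simp
  qed
  have "mat_adjoint V * A' = four_block_mat (1\<^sub>m 1 * E) (0\<^sub>m 1 k) (0\<^sub>m k 1) (mat_adjoint U * B)"
    unfolding V' blocks by (rule block_diagonal_mult[OF one E U' B])
  also have "1\<^sub>m 1 * E = E" using E by simp
  also have "four_block_mat E (0\<^sub>m 1 k) (0\<^sub>m k 1) (mat_adjoint U * B) * V
      = four_block_mat (E * 1\<^sub>m 1) (0\<^sub>m 1 k) (0\<^sub>m k 1) (mat_diag k (\<lambda>r. es ! r))"
    unfolding V_def diag[symmetric] by (rule block_diagonal_mult[OF E one _ U]) (use U' B in simp)
  also have "E * 1\<^sub>m 1 = E" using E by simp
  also have "four_block_mat E (0\<^sub>m 1 k) (0\<^sub>m k 1) (mat_diag k (\<lambda>r. es ! r)) = mat_diag n (\<lambda>r. (e # es) ! r)"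
    unfolding n by (intro eq_matI) (auto simp: E_def mat_diag_def nth_Cons')
  finally have VAV: "mat_adjoint V * A' * V = mat_diag n (\<lambda>r. (e # es) ! r)" .
  have adj: "mat_adjoint (W * V) = mat_adjoint V * mat_adjoint W" using mat_adjoint_mult[OF W V] .
  have "mat_adjoint (W * V) * (W * V) = mat_adjoint V * (mat_adjoint W * W) * V"
    unfolding adj using V Vc W W' by (simp add: assoc_mult_mat[of _ n n _ n _ n])
  then have "mat_adjoint (W * V) * (W * V) = 1\<^sub>m n" using V Vc VV by (simp add: WW)
  moreover have "mat_adjoint (W * V) * A * (W * V) = mat_adjoint V * A' * V"
    unfolding adj A'_def using A V Vc W W' by (simp add: assoc_mult_mat[of _ n n _ n _ n])
  ultimately show ?case using V W VAV by (intro bexI[of _ "W * V"]) auto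
qed

section \<open>Frame operators in an eigenbasis\<close>

lemma proots_linear_factors: "proots (\<Prod>a\<leftarrow>xs. [:- a, 1:]) = mset (xs :: complex list)"
proof (induction xs)
  case (Cons a xs)
  have "(\<Prod>a\<leftarrow>xs. [:- a, 1:]) \<noteq> 0" by (auto simp: prod_list_zero_iff)
  then show ?case using Cons by (simp add: proots_mult del: mult_pCons_left)
qed simp

lemma cvec_norm_square: "(cvec_norm v)\<^sup>2 = (\<Sum>r<dim_vec v. (cmod (v $ r))\<^sup>2)"
  by (simp add: cvec_norm_def L2_set_def sum_nonneg)

lemma frame_operator_factorization:
  assumes F: "set F \<subseteq> carrier_vec k"
  shows "frame_operator k F = mat_of_cols k F * mat_adjoint (mat_of_cols k F)"
proof (rule eq_matI)
  fix r c assume "r < dim_row (mat_of_cols k F * mat_adjoint (mat_of_cols k F))"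
    "c < dim_col (mat_of_cols k F * mat_adjoint (mat_of_cols k F))"
  then have "r < k" "c < k" by auto
  then show "frame_operator k F $$ (r, c) = (mat_of_cols k F * mat_adjoint (mat_of_cols k F)) $$ (r, c)"
    by (simp add: frame_operator_index[OF F] scalar_prod_def atLeast0LessThan mat_of_cols_index)
qed (use frame_operator_carrier[of k F] in auto)

text \<open>The complex roots are listed by decreasing real part. In this order the list matches the vector of
eigenvalues entry by entry before the roots are known to be real.\<close>

lemma eigenvalue_vector_as_factorization:
  assumes "(A :: complex mat) \<in> carrier_mat k k"
  shows "\<exists>es. char_poly A = (\<Prod>a\<leftarrow>es. [:- a, 1:]) \<and> length es = k \<and> eigenvalue_vector A = map Re es"
proof -
  obtain as where as: "char_poly A = (\<Prod>a\<leftarrow>as. [:- a, 1:])" "length as = k"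
    using char_poly_factorized[OF assms] by blast
  define es where "es = rev (sort_key Re as)"
  have "mset es = mset as" by (simp add: es_def)
  then have "mset (map (\<lambda>a. [:- a, 1:]) es) = mset (map (\<lambda>a. [:- a, 1:]) as)" by simp
  then have "char_poly A = (\<Prod>a\<leftarrow>es. [:- a, 1:])" unfolding as(1) by (metis prod_mset_prod_list)
  moreover have "sort (map Re as) = map Re (sort_key Re as)" by (intro properties_for_sort) auto
  then have "eigenvalue_vector A = map Re es"
    unfolding eigenvalue_vector_def as(1) proots_linear_factors
    by (simp add: es_def rev_map flip: mset_map)
  ultimately show ?thesis using as(2) by (auto simp: es_def)
qed

text \<open>Let \<open>T\<close> have the vectors of \<open>F\<close> as columns, so that the frame operator \<open>S\<close> is
\<open>T T\<^sup>*\<close>, and let \<open>U\<close> diagonalize it. The coordinates \<open>G = U\<^sup>* T\<close> in the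
eigenbasis satisfy \<open>G G\<^sup>* = U\<^sup>* S U\<close>, so their rows are orthogonal with the
eigenvalues as squared lengths, and \<open>G\<^sup>* G = T\<^sup>* T\<close>, so the norms of the
vectors are unchanged.\<close>

lemma frame_in_eigenbasis:
  assumes F: "set F \<subseteq> carrier_vec k" and \<mu>: "eigenvalue_vector (frame_operator k F) = \<mu>"
  shows "\<exists>g. (\<forall>r<k. \<forall>s<k. row_gram (length F) g r s = (if r = s then of_real (\<mu> ! r) else 0))
    \<and> (\<forall>i<length F. column_energy {..<k} g i = (cvec_norm (F ! i))\<^sup>2)"
proof -
  define n where "n = length F"
  define T where "T = mat_of_cols k F"
  define S where "S = frame_operator k F"
  have T: "T \<in> carrier_mat k n" by (simp add: T_def n_def)
  have T': "mat_adjoint T \<in> carrier_mat n k" using T by simp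
  have S: "S \<in> carrier_mat k k" by (simp add: S_def frame_operator_carrier)
  have ST: "S = T * mat_adjoint T" unfolding S_def T_def by (rule frame_operator_factorization[OF F])
  have herm: "mat_adjoint S = S" unfolding ST using mat_adjoint_mult[OF T T'] by simp
  obtain es where es: "char_poly S = (\<Prod>a\<leftarrow>es. [:- a, 1:])" "length es = k" "\<mu> = map Re es"
    using eigenvalue_vector_as_factorization[OF S] \<mu> by (auto simp: S_def)
  obtain U where U: "U \<in> carrier_mat k k" and UU: "mat_adjoint U * U = 1\<^sub>m k"
    and diag: "mat_adjoint U * S * U = mat_diag k (\<lambda>r. es ! r)"
    using hermitian_unitary_diagonalization[OF S herm es(1)] by blast
  have U': "mat_adjoint U \<in> carrier_mat k k" using U by simp
  have UU': "U * mat_adjoint U = 1\<^sub>m k" using mat_mult_left_right_inverse[OF U' U UU] .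
  define G where "G = mat_adjoint U * T"
  have G: "G \<in> carrier_mat k n" using mult_carrier_mat[OF U' T] by (simp add: G_def)
  have G': "mat_adjoint G = mat_adjoint T * U" using mat_adjoint_mult[OF U' T] by (simp add: G_def)
  have "G * mat_adjoint G = mat_adjoint U * S * U"
    unfolding G' unfolding G_def ST
    using U U' T T' by (simp add: assoc_mult_mat[of _ k n _ k _ k] assoc_mult_mat[of _ k k _ n _ k]
        assoc_mult_mat[of _ k k _ k _ k] mult_carrier_mat[of _ k n _ k] mult_carrier_mat[of _ n k _ k])
  then have GG: "G * mat_adjoint G = mat_diag k (\<lambda>r. es ! r)" by (simp add: diag)
  have "mat_adjoint G * G = mat_adjoint T * ((U * mat_adjoint U) * T)"
    unfolding G' unfolding G_def
    using U U' T T' by (simp add: assoc_mult_mat[of _ n k _ k _ n] assoc_mult_mat[of _ k k _ k _ n]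
        mult_carrier_mat[of _ k k _ n])
  then have GT: "mat_adjoint G * G = mat_adjoint T * T" using T by (simp add: UU')
  define g where "g i r = G $$ (r, i)" for i r
  have gram: "row_gram n g r s = (if r = s then es ! r else 0)" if "r < k" "s < k" for r s
    using arg_cong[OF GG, of "\<lambda>M. M $$ (r, s)"] G that
    by (simp add: scalar_prod_def atLeast0LessThan row_gram_def g_def mat_diag_def)
  \<comment> \<open>The eigenvalues are squared lengths of rows, hence real.\<close>
  have "es ! r = of_real (Re (es ! r))" if "r < k" for r
    using gram[OF that that] unfolding row_gram_diagonal by (metis Re_complex_of_real)
  then have "row_gram n g r s = (if r = s then of_real (\<mu> ! r) else 0)" if "r < k" "s < k" for r s
    using gram[OF that] that by (simp add: es)
  moreover have "column_energy {..<k} g i = (cvec_norm (F ! i))\<^sup>2" if i: "i < n" for i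
  proof -
    have Fi: "F ! i \<in> carrier_vec k" using F i by (auto simp: n_def)
    have "(\<Sum>r<k. cnj (G $$ (r, i)) * G $$ (r, i)) = (\<Sum>r<k. cnj (T $$ (r, i)) * T $$ (r, i))"
      using arg_cong[OF GT, of "\<lambda>M. M $$ (i, i)"] G T i
      by (simp add: scalar_prod_def atLeast0LessThan)
    then have "complex_of_real (column_energy {..<k} g i) = of_real ((cvec_norm (F ! i))\<^sup>2)"
      using Fi i unfolding column_energy_def cvec_norm_square of_real_sum
      by (simp add: complex_norm_square g_def T_def n_def mat_of_cols_index mult.commute del: of_real_power)
    then show ?thesis by (simp only: of_real_eq_iff)
  qed
  ultimately show ?thesis unfolding n_def by blast
qed

lemma frame_norms_le_largest_eigenvalues:
  assumes F: "set F \<subseteq> carrier_vec k" and \<mu>: "eigenvalue_vector (frame_operator k F) = \<mu>"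
    and len: "length \<mu> = k" and l: "l \<le> length F"
  shows "(\<Sum>i<l. (cvec_norm (F ! i))\<^sup>2) \<le> (\<Sum>r<l. if r < k then \<mu> ! r else 0)"
proof -
  obtain g where gram: "\<And>r s. r < k \<Longrightarrow> s < k \<Longrightarrow>
      row_gram (length F) g r s = (if r = s then of_real (\<mu> ! r) else 0)"
    and energy: "\<And>i. i < length F \<Longrightarrow> column_energy {..<k} g i = (cvec_norm (F ! i))\<^sup>2"
    using frame_in_eigenbasis[OF F \<mu>] by blast
  have sorted: "sorted_wrt (\<ge>) \<mu>"
    unfolding \<mu>[symmetric] eigenvalue_vector_def by (simp add: sorted_wrt_rev)
  have "(\<Sum>i<l. column_energy {..<k} g i) \<le> (\<Sum>r<l. if r < k then \<mu> ! r else 0)"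
    using column_energies_le_largest[OF gram _ l] nth_decreasing[OF sorted] len by blast
  then show ?thesis using energy l by simp
qed

lemma frame_norms_sum_eigenvalues:
  assumes F: "set F \<subseteq> carrier_vec k" and \<mu>: "eigenvalue_vector (frame_operator k F) = \<mu>"
  shows "(\<Sum>i<length F. (cvec_norm (F ! i))\<^sup>2) = (\<Sum>r<k. \<mu> ! r)"
proof -
  obtain g where gram: "\<And>r s. r < k \<Longrightarrow> s < k \<Longrightarrow>
      row_gram (length F) g r s = (if r = s then of_real (\<mu> ! r) else 0)"
    and energy: "\<And>i. i < length F \<Longrightarrow> column_energy {..<k} g i = (cvec_norm (F ! i))\<^sup>2"
    using frame_in_eigenbasis[OF F \<mu>] by blast
  have row: "(\<Sum>i<length F. (cmod (g i r))\<^sup>2) = \<mu> ! r" if "r < k" for r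
    using gram[OF that that] unfolding row_gram_diagonal by (simp only: of_real_eq_iff simp_thms if_True)
  have "(\<Sum>i<length F. (cvec_norm (F ! i))\<^sup>2) = (\<Sum>i<length F. column_energy {..<k} g i)"
    by (simp add: energy)
  also have "\<dots> = (\<Sum>r<k. \<Sum>i<length F. (cmod (g i r))\<^sup>2)"
    unfolding column_energy_def by (rule sum.swap)
  also have "\<dots> = (\<Sum>r<k. \<mu> ! r)" by (simp add: row)
  finally show ?thesis .
qed

section \<open>Realization of spectra and norms\<close>

text \<open>If the rows are orthogonal, the frame operator is diagonal already.\<close>

lemma eigenvalue_vector_of_orthogonal_rows:
  assumes gram: "\<And>r s. r < k \<Longrightarrow> s < k \<Longrightarrow> row_gram n g r s = (if r = s then of_real (\<mu> ! r) else 0)"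
    and \<mu>: "length \<mu> = k" "sorted_wrt (\<ge>) \<mu>"
  shows "eigenvalue_vector (frame_operator k (map (\<lambda>i. vec k (g i)) [0..<n])) = \<mu>"
proof (rule eigenvalue_vector_eq[OF _ \<mu>(2)])
  define F where "F = map (\<lambda>i. vec k (g i)) [0..<n]"
  have F: "set F \<subseteq> carrier_vec k" by (auto simp: F_def)
  have S: "frame_operator k F = mat_diag k (\<lambda>r. of_real (\<mu> ! r))"
  proof (rule eq_matI)
    fix r s assume "r < dim_row (mat_diag k (\<lambda>r. complex_of_real (\<mu> ! r)))"
      "s < dim_col (mat_diag k (\<lambda>r. complex_of_real (\<mu> ! r)))"
    then have rs: "r < k" "s < k" by (auto simp: mat_diag_def)
    have "frame_operator k F $$ (r, s) = row_gram n g r s"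
      using rs unfolding frame_operator_index[OF F rs] row_gram_def by (simp add: F_def)
    then show "frame_operator k F $$ (r, s) = mat_diag k (\<lambda>r. of_real (\<mu> ! r)) $$ (r, s)"
      using rs by (simp add: gram mat_diag_def)
  qed (use frame_operator_carrier[of k F] in \<open>auto simp: mat_diag_def\<close>)
  have "upper_triangular (mat_diag k (\<lambda>r. complex_of_real (\<mu> ! r)))"
    by (auto simp: upper_triangular_def mat_diag_def)
  then have "char_poly (frame_operator k F) = (\<Prod>a\<leftarrow>diag_mat (mat_diag k (\<lambda>r. complex_of_real (\<mu> ! r))). [:- a, 1:])"
    unfolding S by (intro char_poly_upper_triangular[of _ k]) auto
  also have "diag_mat (mat_diag k (\<lambda>r. complex_of_real (\<mu> ! r))) = map of_real \<mu>"
    using \<mu>(1) by (intro nth_equalityI) (auto simp: diag_mat_def mat_diag_def)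
  finally show "char_poly (frame_operator k (map (\<lambda>i. vec k (g i)) [0..<n]))
      = (\<Prod>a\<leftarrow>\<mu>. [:- complex_of_real a, 1:])"
    by (simp add: F_def o_def)
qed

text \<open>The diagonal matrices with entries \<open>sqrt (\<mu> j r)\<close> realize the spectra \<open>\<mu> j\<close>, and the
\<open>i\<close>-th columns of the stacked matrix have total energy \<open>\<Sum>j<m. \<mu> j i\<close>. Rotations of
pairs of columns then lead to every decreasing energy vector majorized by this one. The
condition \<open>d j \<le> n\<close> provides a column for each diagonal entry.\<close>

lemma columns_with_prescribed_energies:
  fixes \<mu> :: "nat \<Rightarrow> nat \<Rightarrow> real" and x :: "nat \<Rightarrow> real"
  assumes nonneg: "\<And>j r. j < m \<Longrightarrow> 0 \<le> \<mu> j r" and dim: "\<And>j. j < m \<Longrightarrow> d j \<le> n"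
    and support: "\<And>j r. j < m \<Longrightarrow> d j \<le> r \<Longrightarrow> \<mu> j r = 0"
    and decreasing: "\<And>i j. i \<le> j \<Longrightarrow> j < n \<Longrightarrow> x j \<le> x i"
    and prefix: "\<And>l. l \<le> n \<Longrightarrow> sum x {..<l} \<le> (\<Sum>r<l. \<Sum>j<m. \<mu> j r)"
    and total: "sum x {..<n} = (\<Sum>r<n. \<Sum>j<m. \<mu> j r)"
  shows "\<exists>h. (\<forall>j<m. \<forall>r<d j. \<forall>s<d j. row_gram n h (j, r) (j, s) = (if r = s then of_real (\<mu> j r) else 0))
    \<and> (\<forall>i<n. column_energy (SIGMA j:{..<m}. {..<d j}) h i = x i)"
proof -
  define K where "K = (SIGMA j:{..<m}. {..<d j})"
  define g where "g i = (\<lambda>(j, r). if i = r then complex_of_real (sqrt (\<mu> j r)) else 0)" for i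
  have gram: "row_gram n g (j, r) (j, s) = (if r = s then of_real (\<mu> j r) else 0)"
    if "j < m" "r < d j" "s < d j" for j r s
  proof -
    have "row_gram n g (j, r) (j, s)
        = (\<Sum>i<n. if i = r then (if r = s then of_real (sqrt (\<mu> j r) * sqrt (\<mu> j r)) else 0) else 0)"
      unfolding row_gram_def g_def by (intro sum.cong) (auto simp flip: of_real_mult)
    also have "\<dots> = (if r = s then of_real (\<mu> j r) else 0)"
      using that dim[OF that(1)] by (simp add: nonneg)
    finally show ?thesis .
  qed
  have energy: "column_energy K g = (\<lambda>i. \<Sum>j<m. \<mu> j i)"
  proof
    fix i
    have "column_energy K g i = (\<Sum>j<m. \<Sum>r<d j. (cmod (g i (j, r)))\<^sup>2)"
      unfolding column_energy_def K_def by (subst sum.Sigma) auto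
    also have "\<dots> = (\<Sum>j<m. \<Sum>r<d j. if r = i then \<mu> j i else 0)"
      using nonneg by (intro sum.cong) (auto simp: g_def)
    also have "\<dots> = (\<Sum>j<m. \<mu> j i)"
      by (intro sum.cong) (auto simp: support)
    finally show "column_energy K g i = (\<Sum>j<m. \<mu> j i)" .
  qed
  have "\<exists>z. (\<exists>h. row_gram n h = row_gram n g \<and> column_energy K h = z) \<and> (\<forall>i<n. z i = x i)"
  proof (rule majorization_reached_by_transfers[OF decreasing prefix total])
    show "\<exists>h. row_gram n h = row_gram n g \<and> column_energy K h = (\<lambda>r. \<Sum>j<m. \<mu> j r)"
      using energy by blast
    fix y p q t
    assume "\<exists>h. row_gram n h = row_gram n g \<and> column_energy K h = y"
      and pq: "p < n" "q < n" "p \<noteq> q" "0 \<le> t" "t \<le> y p - y q"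
    then obtain h where "row_gram n h = row_gram n g" "column_energy K h = y" by blast
    then show "\<exists>h. row_gram n h = row_gram n g \<and> column_energy K h = y(p := y p - t, q := y q + t)"
      using rotate_columns[OF pq(1-4), of K h] pq(5) by metis
  qed
  then obtain h where "row_gram n h = row_gram n g" "\<And>i. i < n \<Longrightarrow> column_energy K h i = x i" by blast
  then show ?thesis using gram unfolding K_def by metis
qed

theorem theorem3p5:
  fixes m n :: nat and d :: "nat list" and \<alpha> :: "real list" and M :: "real list list"
  assumes "1 \<le> m" and "1 \<le> n"
    and "length d = m" and "\<forall>j<m. 1 \<le> d ! j" and "sorted_wrt (\<ge>) d"
    and "length \<alpha> = n" and "\<forall>i<n. 0 \<le> \<alpha> ! i" and "sorted_wrt (\<ge>) \<alpha>"
    and "d ! 0 \<le> n"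
    and "length M = m" and "\<forall>j<m. length (M ! j) = d ! j"
    and "\<forall>j<m. \<forall>i<d ! j. 0 \<le> M ! j ! i" and "\<forall>j<m. sorted_wrt (\<ge>) (M ! j)"
  shows "admissible \<alpha> d M \<longleftrightarrow> \<alpha> \<prec> sigma_vector d M"
proof -
  have d: "d ! j \<le> d ! 0" if "j < m" for j
    using nth_decreasing[OF assms(5), of 0 j] assms(3) that by simp
  define \<mu> where "\<mu> j r = (if r < d ! j then M ! j ! r else 0)" for j r
  define \<sigma> where "\<sigma> r = (\<Sum>j<m. \<mu> j r)" for r
  have nonneg: "0 \<le> \<mu> j r" if "j < m" for j r
    using assms(12) that by (auto simp: \<mu>_def)
  have mono: "\<mu> j s \<le> \<mu> j r" if "j < m" "r \<le> s" for j r s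
    using nth_decreasing[of "M ! j" r s] assms(11,13) that nonneg[OF that(1), of r]
    by (auto simp: \<mu>_def)
  have len: "length (sigma_vector d M) = d ! 0" by (simp add: sigma_vector_def)
  have nth: "sigma_vector d M ! r = \<sigma> r" if "r < d ! 0" for r
    using that assms(3,11) by (simp add: sigma_vector_def \<sigma>_def zero_pad_nth \<mu>_def)
  have \<sigma>_mono: "\<sigma> s \<le> \<sigma> r" if "r \<le> s" for r s
    unfolding \<sigma>_def using mono that by (intro sum_mono) auto
  have \<sigma>_nonneg: "0 \<le> \<sigma> r" for r
    unfolding \<sigma>_def using nonneg by (intro sum_nonneg) auto
  have \<sigma>_zero: "\<sigma> r = 0" if "\<not> r < d ! 0" for r
    unfolding \<sigma>_def using that d by (intro sum.neutral) (force simp: \<mu>_def)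
  have \<sigma>_sum: "(\<Sum>r<l. \<sigma> r) = (\<Sum>j<m. \<Sum>r<l. \<mu> j r)" for l
    unfolding \<sigma>_def by (rule sum.swap)
  have "sorted_wrt (\<ge>) (sigma_vector d M)"
    using \<sigma>_mono by (auto simp: sorted_wrt_iff_nth_less len nth)
  moreover have "\<forall>v\<in>set (sigma_vector d M). 0 \<le> v"
    using \<sigma>_nonneg by (auto simp: in_set_conv_nth len nth)
  moreover have "zero_pad n (sigma_vector d M) ! r = \<sigma> r" if "r < n" for r
    using that by (simp add: zero_pad_nth len nth \<sigma>_zero)
  then have "(\<Sum>r<l. zero_pad n (sigma_vector d M) ! r) = (\<Sum>r<l. \<sigma> r)" if "l \<le> n" for l
    using that by (intro sum.cong) auto
  ultimately have majorized: "\<alpha> \<prec> sigma_vector d M \<longleftrightarrow>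
      (\<forall>l\<le>n. (\<Sum>i<l. \<alpha> ! i) \<le> (\<Sum>r<l. \<sigma> r)) \<and> (\<Sum>i<n. \<alpha> ! i) = (\<Sum>r<n. \<sigma> r)"
    using majorized_by_sorted[OF assms(6,8), of "sigma_vector d M"] assms(9) by (simp add: len)
  show ?thesis unfolding majorized
  proof
    assume "admissible \<alpha> d M"
    then obtain \<Phi> where \<Phi>: "\<Phi> \<in> designs \<alpha> d"
      and eig: "\<And>j. j < m \<Longrightarrow> eigenvalue_vector (frame_operator (d ! j) (\<Phi> ! j)) = M ! j"
      unfolding admissible_def assms(3) by blast
    have F: "length (\<Phi> ! j) = n" "set (\<Phi> ! j) \<subseteq> carrier_vec (d ! j)" if "j < m" for j
      using \<Phi> that assms(3,6) by (auto simp: designs_def)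
    have \<alpha>: "\<alpha> ! i = (\<Sum>j<m. (cvec_norm (\<Phi> ! j ! i))\<^sup>2)" if "i < n" for i
      using \<Phi> that assms(3,6) by (simp add: designs_def)
    have \<alpha>_sum: "(\<Sum>i<l. \<alpha> ! i) = (\<Sum>j<m. \<Sum>i<l. (cvec_norm (\<Phi> ! j ! i))\<^sup>2)" if "l \<le> n" for l
    proof -
      have "(\<Sum>i<l. \<alpha> ! i) = (\<Sum>i<l. \<Sum>j<m. (cvec_norm (\<Phi> ! j ! i))\<^sup>2)"
        using that by (intro sum.cong) (auto simp: \<alpha>)
      then show ?thesis by (simp only: sum.swap[of _ "{..<m}"])
    qed
    have "(\<Sum>i<l. (cvec_norm (\<Phi> ! j ! i))\<^sup>2) \<le> (\<Sum>r<l. \<mu> j r)" if "j < m" "l \<le> n" for j l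
      unfolding \<mu>_def using that F assms(11) by (intro frame_norms_le_largest_eigenvalues eig) auto
    then have "(\<Sum>i<l. \<alpha> ! i) \<le> (\<Sum>r<l. \<sigma> r)" if "l \<le> n" for l
      using that unfolding \<alpha>_sum[OF that] \<sigma>_sum by (intro sum_mono[of "{..<m}"]) simp
    moreover have "(\<Sum>i<n. (cvec_norm (\<Phi> ! j ! i))\<^sup>2) = (\<Sum>r<n. \<mu> j r)" if j: "j < m" for j
    proof -
      have "(\<Sum>i<n. (cvec_norm (\<Phi> ! j ! i))\<^sup>2) = (\<Sum>r<d ! j. M ! j ! r)"
        using frame_norms_sum_eigenvalues[OF F(2) eig, OF j j] F(1)[OF j] by simp
      also have "\<dots> = (\<Sum>r<n. \<mu> j r)"
        using d[OF j] assms(9) by (intro sum.mono_neutral_cong_left) (auto simp: \<mu>_def)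
      finally show ?thesis .
    qed
    then have "(\<Sum>i<n. \<alpha> ! i) = (\<Sum>r<n. \<sigma> r)" by (simp add: \<alpha>_sum \<sigma>_sum)
    ultimately show "(\<forall>l\<le>n. (\<Sum>i<l. \<alpha> ! i) \<le> (\<Sum>r<l. \<sigma> r)) \<and> (\<Sum>i<n. \<alpha> ! i) = (\<Sum>r<n. \<sigma> r)"
      by blast
  next
    assume major: "(\<forall>l\<le>n. (\<Sum>i<l. \<alpha> ! i) \<le> (\<Sum>r<l. \<sigma> r)) \<and> (\<Sum>i<n. \<alpha> ! i) = (\<Sum>r<n. \<sigma> r)"
    have "\<exists>h. (\<forall>j<m. \<forall>r<d ! j. \<forall>s<d ! j. row_gram n h (j, r) (j, s) = (if r = s then of_real (\<mu> j r) else 0))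
      \<and> (\<forall>i<n. column_energy (SIGMA j:{..<m}. {..<d ! j}) h i = \<alpha> ! i)"
    proof (rule columns_with_prescribed_energies[OF nonneg])
      show "d ! j \<le> n" if "j < m" for j using d[OF that] assms(9) by simp
      show "\<mu> j r = 0" if "d ! j \<le> r" for j r using that by (simp add: \<mu>_def)
      show "\<alpha> ! j \<le> \<alpha> ! i" if "i \<le> j" "j < n" for i j
        using nth_decreasing[OF assms(8)] assms(6) that by simp
    qed (use major in \<open>auto simp: \<sigma>_def\<close>)
    then obtain h where
      gram: "\<And>j r s. j < m \<Longrightarrow> r < d ! j \<Longrightarrow> s < d ! j \<Longrightarrow>
        row_gram n h (j, r) (j, s) = (if r = s then of_real (\<mu> j r) else 0)"
      and energy: "\<And>i. i < n \<Longrightarrow> column_energy (SIGMA j:{..<m}. {..<d ! j}) h i = \<alpha> ! i"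
      by blast
    define \<Phi> where "\<Phi> = map (\<lambda>j. map (\<lambda>i. vec (d ! j) (\<lambda>r. h i (j, r))) [0..<n]) [0..<m]"
    have "(\<Sum>j<m. (cvec_norm (\<Phi> ! j ! i))\<^sup>2) = \<alpha> ! i" if "i < n" for i
    proof -
      have "(\<Sum>j<m. (cvec_norm (\<Phi> ! j ! i))\<^sup>2) = (\<Sum>j<m. \<Sum>r<d ! j. (cmod (h i (j, r)))\<^sup>2)"
        using that by (intro sum.cong) (auto simp: \<Phi>_def cvec_norm_square)
      also have "\<dots> = column_energy (SIGMA j:{..<m}. {..<d ! j}) h i"
        unfolding column_energy_def by (subst sum.Sigma) auto
      finally show ?thesis using energy[OF that] by simp
    qed
    then have "\<Phi> \<in> designs \<alpha> d"
      using assms(3,6) by (auto simp: designs_def \<Phi>_def)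
    moreover have "eigenvalue_vector (frame_operator (d ! j) (\<Phi> ! j)) = M ! j" if j: "j < m" for j
    proof -
      have "row_gram n (\<lambda>i r. h i (j, r)) r s = (if r = s then of_real (M ! j ! r) else 0)"
        if "r < d ! j" "s < d ! j" for r s
        using gram[OF j that] that by (simp add: row_gram_def \<mu>_def)
      then have "eigenvalue_vector (frame_operator (d ! j) (map (\<lambda>i. vec (d ! j) (\<lambda>r. h i (j, r))) [0..<n])) = M ! j"
        by (rule eigenvalue_vector_of_orthogonal_rows) (use assms(11,13) j in auto)
      then show ?thesis using j by (simp add: \<Phi>_def)
    qed
    ultimately show "admissible \<alpha> d M" unfolding admissible_def assms(3) by blast
  qed
qed

end
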